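(* Let $k\geqslant1$ be an odd integer and put $N=k+1$ (so $N$ is even). Let $W^{0,1,\ldots,N-1}$ be the usual Wronskian determinant of $N$ functions of one real variable $x$, and let $F^{(N)}_n$ be the $N$-bonacci numbers. Then for every integer $n\geqslant 0$, $$W^{0,1,\ldots,N-1}\Bigl(x^{F^{(N)}_{n}+N/2},\,x^{F^{(N)}_{n+1}+N/2},\ldots,x^{F^{(N)}_{n+N-1}+N/2}\Bigr)=\prod_{0\leqslant i<j<N}\Bigl(F^{(N)}_{n+j}-F^{(N)}_{n+i}\Bigr)\cdot x^{F^{(N)}_{n+N}+N/2},$$ and for all $n\geqslant N$ every factor $F^{(N)}_{n+j}-F^{(N)}_{n+i}$ ($0\leqslant i<j<N$) is positive, so that the coefficient of the monomial on the right-hand side does not vanish.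
   Context: $W^{0,1,\ldots,N-1}(f_1,\ldots,f_N)$ is the determinant of the $N\times N$ matrix whose rows are the derivatives of orders $0,1,\ldots,N-1$ of $(f_1,\ldots,f_N)$ with respect to $x$. The $N$-bonacci numbers are $F^{(N)}_0=\cdots=F^{(N)}_{N-2}=0$, $F^{(N)}_{N-1}=1$, and $F^{(N)}_n=F^{(N)}_{n-1}+\cdots+F^{(N)}_{n-N}$ for $n\geqslant N$. *)

theory Defs
  imports "HOL-Analysis.Derivative" "Jordan_Normal_Form.Determinant"
begin

fun nbonacci :: "nat \<Rightarrow> nat \<Rightarrow> nat" where
  "nbonacci N n =
     (if n + 1 < N then 0
      else if n + 1 = N then 1
      else (\<Sum>i = 1..N. nbonacci N (n - i)))"

declare nbonacci.simps [simp del]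

(* The functions are f 0, ..., f (N - 1); row i holds their i-th derivatives at x. *)
definition wronskian :: "nat \<Rightarrow> (nat \<Rightarrow> real \<Rightarrow> real) \<Rightarrow> real \<Rightarrow> real" where
  "wronskian N f x = det (mat N N (\<lambda>(i, j). (deriv ^^ i) (f j) x))"

end

theory Submission
  imports Defs
begin

text \<open>
  The Wronskian of monomials \<open>t ^ a j\<close>, \<open>j < N\<close>, has entries
  \<open>a j (a j - 1) \<dots> (a j - i + 1) \<cdot> x ^ (a j - i)\<close>. In the Leibniz expansion every nonzero term
  carries the same power of \<open>x\<close>, with exponent
  \<open>(\<Sum>j<N. a j) - N (N - 1) / 2\<close>, so this power factors out and leaves the determinant of the
  falling factorials of the exponents. That determinant is the Vandermonde product of the \<open>a j\<close>
  (\<open>det_node_products\<close>), because row \<open>i\<close> consists of the values of a monic polynomial of degree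
  \<open>i\<close>.

  For \<open>a j = F (n + j) + N / 2\<close>, with \<open>F\<close> the \<open>N\<close>-bonacci sequence, the recurrence
  \<open>F n + \<dots> + F (n + N - 1) = F (n + N)\<close> turns the exponent into
  \<open>F (n + N) + N \<cdot> N / 2 - N (N - 1) / 2 = F (n + N) + N / 2\<close>; the shift by \<open>N / 2\<close> is chosen so
  that it reappears, which makes the Wronskian of \<open>N\<close> consecutive monomials the next monomial up to
  a factor. The factor is positive for \<open>n \<ge> N\<close> because \<open>F\<close> is strictly increasing from index \<open>N\<close>
  on: each value exceeds its predecessor by at least the value before that.
\<close>

section \<open>A Vandermonde determinant\<close>

text \<open>
  The coefficients in \<open>newton_expansion\<close> below. The recursion comes from writing
  \<open>x - c i = (x - b l) + (b l - c i)\<close> in the product with the \<open>l\<close>-th Newton polynomial.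
\<close>

fun newton_coeff :: "(nat \<Rightarrow> 'a::comm_ring_1) \<Rightarrow> (nat \<Rightarrow> 'a) \<Rightarrow> nat \<Rightarrow> nat \<Rightarrow> 'a" where
  "newton_coeff b c 0 l = (if l = 0 then 1 else 0)"
| "newton_coeff b c (Suc i) l =
     (if l = 0 then 0 else newton_coeff b c i (l - 1)) + (b l - c i) * newton_coeff b c i l"

lemma newton_coeff_above_diag: "i < l \<Longrightarrow> newton_coeff b c i l = 0"
  by (induction i arbitrary: l) auto

lemma newton_coeff_diag: "newton_coeff b c i i = 1"
  by (induction i) (auto simp: newton_coeff_above_diag)

lemma newton_expansion:
  fixes x :: "'a::comm_ring_1"
  assumes "i < n"
  shows "(\<Prod>m<i. x - c m) = (\<Sum>l<n. newton_coeff b c i l * (\<Prod>m<l. x - b m))"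
  using assms
proof (induction i)
  case 0
  then obtain n' where n: "n = Suc n'"
    by (cases n) auto
  show ?case
    unfolding n sum.lessThan_Suc_shift by simp
next
  case (Suc i)
  then obtain n' where n: "n = Suc n'" "i < n'"
    by (cases n) auto
  let ?L = "newton_coeff b c i" and ?P = "\<lambda>l. \<Prod>m<l. x - b m"
  \<comment> \<open>The last summand of the expansion vanishes, so the shift by one index stays in range.\<close>
  have last: "?L n' = 0"
    using n by (simp add: newton_coeff_above_diag)
  have "(\<Prod>m<Suc i. x - c m) = (\<Sum>l<n. ?L l * ?P l) * (x - c i)"
    using Suc by simp
  also have "\<dots> = (\<Sum>l<n. ?L l * ?P (Suc l) + (b l - c i) * ?L l * ?P l)"
    unfolding sum_distrib_right by (intro sum.cong refl) (simp add: algebra_simps)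
  also have "\<dots> = (\<Sum>l<n. ?L l * ?P (Suc l)) + (\<Sum>l<n. (b l - c i) * ?L l * ?P l)"
    by (rule sum.distrib)
  also have "(\<Sum>l<n. ?L l * ?P (Suc l)) = (\<Sum>l<n'. ?L l * ?P (Suc l))"
    using last by (simp add: n)
  also have "\<dots> = (\<Sum>l<n. (if l = 0 then 0 else ?L (l - 1)) * ?P l)"
    unfolding n(1) sum.lessThan_Suc_shift by simp
  also have "\<dots> + (\<Sum>l<n. (b l - c i) * ?L l * ?P l)
      = (\<Sum>l<n. newton_coeff b c (Suc i) l * ?P l)"
    unfolding sum.distrib[symmetric] by (intro sum.cong refl) (simp add: algebra_simps)
  finally show ?case .
qed

lemma prod_strict_pairs:
  fixes g :: "nat \<Rightarrow> nat \<Rightarrow> 'a::comm_monoid_mult"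
  shows "(\<Prod>j<n. \<Prod>i<j. g i j) = (\<Prod>(i, j) \<in> {(i, j). i < j \<and> j < n}. g i j)"
proof -
  have "(\<Prod>j<n. \<Prod>i<j. g i j) = (\<Prod>(j, i) \<in> (SIGMA j:{..<n}. {..<j}). g i j)"
    by (rule prod.Sigma) auto
  also have "\<dots> = (\<Prod>(i, j) \<in> {(i, j). i < j \<and> j < n}. g i j)"
    by (rule prod.reindex_bij_witness[of _ prod.swap prod.swap]) auto
  finally show ?thesis .
qed

text \<open>
  Expanding the rows in the Newton basis with nodes \<open>a 0, a 1, \<dots>\<close> is an LU factorisation: the
  coefficients form a lower unitriangular matrix, and the \<open>i\<close>-th Newton polynomial vanishes at
  \<open>a j\<close> for \<open>j < i\<close>. The choice \<open>c = 0\<close> gives the usual Vandermonde matrix, \<open>c m = m\<close> the matrix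
  of falling factorials.
\<close>

lemma det_node_products:
  fixes a c :: "nat \<Rightarrow> 'a::comm_ring_1"
  shows "det (mat n n (\<lambda>(i, j). \<Prod>m<i. a j - c m))
    = (\<Prod>(i, j) \<in> {(i, j). i < j \<and> j < n}. a j - a i)"
proof -
  define L where "L = mat n n (\<lambda>(i, l). newton_coeff a c i l)"
  define U where "U = mat n n (\<lambda>(l, j). \<Prod>m<l. a j - a m)"
  have carrier: "L \<in> carrier_mat n n" "U \<in> carrier_mat n n"
    by (auto simp: L_def U_def)
  have "mat n n (\<lambda>(i, j). \<Prod>m<i. a j - c m) = L * U"
  proof (rule eq_matI)
    fix i j assume "i < dim_row (L * U)" "j < dim_col (L * U)"
    then have ij: "i < n" "j < n"
      using carrier by auto
    have "(L * U) $$ (i, j) = (\<Sum>l<n. newton_coeff a c i l * (\<Prod>m<l. a j - a m))"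
      using ij by (simp add: L_def U_def scalar_prod_def atLeast0LessThan)
    then show "mat n n (\<lambda>(i, j). \<Prod>m<i. a j - c m) $$ (i, j) = (L * U) $$ (i, j)"
      using ij newton_expansion[OF ij(1), of "a j" c a] by simp
  qed (use carrier in auto)
  then have "det (mat n n (\<lambda>(i, j). \<Prod>m<i. a j - c m)) = det L * det U"
    using det_mult carrier by metis
  also have "det L = 1"
  proof -
    have "det L = prod_list (diag_mat L)"
      by (rule det_lower_triangular[OF _ carrier(1)]) (auto simp: L_def newton_coeff_above_diag)
    then show ?thesis
      unfolding prod_list_diag_prod by (simp add: L_def newton_coeff_diag)
  qed
  also have "det U = (\<Prod>j<n. \<Prod>i<j. a j - a i)"
  proof -
    have "(\<Prod>m<l. a j - a m) = 0" if "j < l" for j l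
      using that by (intro prod_zero) auto
    then have "det U = prod_list (diag_mat U)"
      by (intro det_upper_triangular[OF _ carrier(2)]) (auto simp: U_def)
    then show ?thesis
      unfolding prod_list_diag_prod by (simp add: U_def atLeast0LessThan)
  qed
  finally show ?thesis
    by (simp add: prod_strict_pairs)
qed


section \<open>Wronskians of monomials\<close>

lemma falling_factorial_eq_0:
  "a < i \<Longrightarrow> (\<Prod>m<i. real a - real m) = 0"
  by (intro prod_zero) auto

text \<open>
  The subtraction in the exponent may be truncated: the coefficient is zero whenever \<open>a < i\<close>.
\<close>

lemma higher_deriv_monomial:
  "(deriv ^^ i) (\<lambda>t::real. t ^ a) = (\<lambda>t. (\<Prod>m<i. real a - real m) * t ^ (a - i))"
proof (induction i)
  case 0
  show ?case by simp
next
  case (Suc i)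
  have "deriv (\<lambda>t. (\<Prod>m<i. real a - real m) * t ^ (a - i)) x
      = (\<Prod>m<Suc i. real a - real m) * x ^ (a - Suc i)" for x :: real
  proof (rule DERIV_imp_deriv)
    have "((\<lambda>t. (\<Prod>m<i. real a - real m) * t ^ (a - i)) has_field_derivative
        (\<Prod>m<i. real a - real m) * (real (a - i) * x ^ (a - i - 1))) (at x)"
      by (auto intro!: derivative_eq_intros)
    moreover have "(\<Prod>m<i. real a - real m) * real (a - i) = (\<Prod>m<Suc i. real a - real m)"
      by (cases "i \<le> a") (auto simp: of_nat_diff falling_factorial_eq_0)
    ultimately show "((\<lambda>t. (\<Prod>m<i. real a - real m) * t ^ (a - i)) has_field_derivative
        (\<Prod>m<Suc i. real a - real m) * x ^ (a - Suc i)) (at x)"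
      by (simp add: mult.assoc[symmetric])
  qed
  then show ?case
    by (simp add: Suc.IH fun_eq_iff)
qed

text \<open>
  In a Leibniz term without a zero coefficient no subtraction \<open>a (p i) - i\<close> is truncated, so the
  exponents sum to a number independent of the permutation \<open>p\<close>. Arguing termwise, instead of
  extracting powers of \<open>x\<close> from rows and columns, includes the point \<open>x = 0\<close>.
\<close>

lemma det_homogeneous:
  fixes C :: "nat \<Rightarrow> nat \<Rightarrow> 'a::comm_ring_1" and a :: "nat \<Rightarrow> nat"
  assumes C: "\<And>i j. a j < i \<Longrightarrow> C i j = 0"
  shows "det (mat n n (\<lambda>(i, j). C i j * x ^ (a j - i)))
    = det (mat n n (\<lambda>(i, j). C i j)) * x ^ ((\<Sum>j<n. a j) - (\<Sum>i<n. i))"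
proof -
  have *: "(\<Prod>i<n. C i (p i) * x ^ (a (p i) - i))
      = (\<Prod>i<n. C i (p i)) * x ^ ((\<Sum>j<n. a j) - (\<Sum>i<n. i))"
    if p: "p permutes {..<n}" for p
  proof (cases "\<forall>i<n. i \<le> a (p i)")
    case True
    then have "(\<Sum>i<n. a (p i) - i) = (\<Sum>i<n. a (p i)) - (\<Sum>i<n. i)"
      by (intro sum_subtractf_nat) auto
    also have "(\<Sum>i<n. a (p i)) = (\<Sum>j<n. a j)"
      using sum.permute[OF p, of a] by (simp add: o_def)
    finally show ?thesis
      by (simp add: prod.distrib power_sum[symmetric])
  next
    case False
    then obtain i where i: "i < n" "C i (p i) = 0"
      using C by (meson not_le)
    then have "(\<Prod>i<n. C i (p i)) = 0" "(\<Prod>i<n. C i (p i) * x ^ (a (p i) - i)) = 0"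
      by (auto intro!: prod_zero bexI[of _ i])
    then show ?thesis
      by simp
  qed
  have entry: "(\<Prod>i = 0..<n. mat n n f $$ (i, p i)) = (\<Prod>i<n. f (i, p i))"
    if "p permutes {..<n}" for p and f :: "nat \<times> nat \<Rightarrow> 'a"
    using permutes_in_image[OF that] unfolding atLeast0LessThan by (intro prod.cong) auto
  show ?thesis
    unfolding det_def'[OF mat_carrier] sum_distrib_right unfolding atLeast0LessThan[of n]
    by (intro sum.cong refl) (use entry * in \<open>simp add: atLeast0LessThan mult.assoc\<close>)
qed

lemma wronskian_monomials:
  "wronskian N (\<lambda>j t. t ^ a j) x
    = (\<Prod>(i, j) \<in> {(i, j). i < j \<and> j < N}. real (a j) - real (a i))
      * x ^ ((\<Sum>j<N. a j) - (\<Sum>i<N. i))"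
proof -
  have "wronskian N (\<lambda>j t. t ^ a j) x
      = det (mat N N (\<lambda>(i, j). (\<Prod>m<i. real (a j) - real m) * x ^ (a j - i)))"
    unfolding wronskian_def higher_deriv_monomial ..
  also have "\<dots> = det (mat N N (\<lambda>(i, j). \<Prod>m<i. real (a j) - real m))
      * x ^ ((\<Sum>j<N. a j) - (\<Sum>i<N. i))"
    by (rule det_homogeneous) (rule falling_factorial_eq_0)
  finally show ?thesis
    by (simp only: det_node_products)
qed


section \<open>The N-bonacci numbers\<close>

lemma nbonacci_recurrence:
  assumes "N \<ge> 1"
  shows "nbonacci N (n + N) = (\<Sum>j<N. nbonacci N (n + j))"
proof -
  have "nbonacci N (n + N) = (\<Sum>i = 1..N. nbonacci N (n + N - i))"
    using assms by (subst nbonacci.simps) auto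
  also have "\<dots> = (\<Sum>j<N. nbonacci N (n + j))"
    by (rule sum.reindex_bij_witness[of _ "\<lambda>j. N - j" "\<lambda>i. N - i"]) auto
  finally show ?thesis .
qed

lemma nbonacci_pos:
  assumes "N \<ge> 1" "n + 1 \<ge> N"
  shows "nbonacci N n > 0"
  using assms(2)
proof (induction n rule: less_induct)
  case (less n)
  show ?case
  proof (cases "n + 1 = N")
    case True
    then show ?thesis
      by (subst nbonacci.simps) auto
  next
    case False
    with less.prems obtain d where d: "n = d + N"
      by (metis Suc_eq_plus1 add.commute le_SucE le_iff_add)
    have "0 < nbonacci N (d + (N - 1))"
      using less.IH[of "d + (N - 1)"] assms(1) d by auto
    also have "\<dots> \<le> (\<Sum>j<N. nbonacci N (d + j))"
      using assms(1) by (intro member_le_sum) auto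
    finally show ?thesis
      using nbonacci_recurrence[OF assms(1)] d by simp
  qed
qed

text \<open>
  The bound \<open>N \<ge> 2\<close> puts two earlier values into the recurrence; for \<open>N = 1\<close> the sequence is
  constant.
\<close>

lemma nbonacci_less_Suc:
  assumes "N \<ge> 2" "n \<ge> N"
  shows "nbonacci N n < nbonacci N (Suc n)"
proof -
  obtain d where d: "Suc n = d + N"
    using assms by (metis le_Suc_eq le_add_diff_inverse2)
  have "nbonacci N n < nbonacci N (n - 1) + nbonacci N n"
    using nbonacci_pos[of N "n - 1"] assms by auto
  also have "\<dots> = (\<Sum>j\<in>{N - 2, N - 1}. nbonacci N (d + j))"
  proof -
    have "n - 1 = d + (N - 2)" "n = d + (N - 1)" "N - 2 \<noteq> N - 1"
      using assms d by auto
    then show ?thesis by simp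
  qed
  also have "\<dots> \<le> (\<Sum>j<N. nbonacci N (d + j))"
    using assms by (intro sum_mono2) auto
  also have "\<dots> = nbonacci N (Suc n)"
    using nbonacci_recurrence[of N d] assms d by simp
  finally show ?thesis .
qed

lemma nbonacci_strict_mono:
  assumes "N \<ge> 2" "N \<le> m" "m < n"
  shows "nbonacci N m < nbonacci N n"
  using assms(3)
proof (induction n)
  case 0
  then show ?case by simp
next
  case (Suc n)
  then show ?case
    using nbonacci_less_Suc[of N n] assms by (cases "m = n") auto
qed


section \<open>Wronskians of N-bonacci monomials\<close>

lemma nbonacci_exponent:
  assumes "even N" "N \<ge> 1"
  shows "(\<Sum>j<N. nbonacci N (n + j) + N div 2) - (\<Sum>i<N. i) = nbonacci N (n + N) + N div 2"
proof -
  have "2 * (\<Sum>i<N. i) = N * (N - 1)"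
    by (induction N) (auto simp: algebra_simps)
  moreover have "N * (N div 2) * 2 = N * (N - 1) + N div 2 * 2"
  proof -
    obtain M where "N = 2 * Suc M"
      using assms by (metis evenE mult_0_right not_one_le_zero not0_implies_Suc)
    then show ?thesis
      by (simp add: algebra_simps)
  qed
  ultimately have "N * (N div 2) = (\<Sum>i<N. i) + N div 2"
    by linarith
  then show ?thesis
    by (simp add: sum.distrib nbonacci_recurrence[OF assms(2)])
qed

theorem mainTheorem3:
  fixes k N :: nat
  assumes "k \<ge> 1" and "odd k" and "N = k + 1"
  shows "(\<forall>n. \<forall>x::real.
            wronskian N (\<lambda>j t. t ^ (nbonacci N (n + j) + N div 2)) x
            = (\<Prod>(i, j) \<in> {(i, j). i < j \<and> j < N}.
                 real (nbonacci N (n + j)) - real (nbonacci N (n + i)))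
              * x ^ (nbonacci N (n + N) + N div 2))
       \<and> (\<forall>n\<ge>N.
            (\<forall>i j. i < j \<and> j < N \<longrightarrow>
               real (nbonacci N (n + j)) - real (nbonacci N (n + i)) > 0)
            \<and> (\<Prod>(i, j) \<in> {(i, j). i < j \<and> j < N}.
                 real (nbonacci N (n + j)) - real (nbonacci N (n + i))) \<noteq> 0)"
proof -
  have N: "even N" "N \<ge> 2"
    using assms by auto
  have wronskian: "wronskian N (\<lambda>j t. t ^ (nbonacci N (n + j) + N div 2)) x
      = (\<Prod>(i, j) \<in> {(i, j). i < j \<and> j < N}.
           real (nbonacci N (n + j)) - real (nbonacci N (n + i)))
        * x ^ (nbonacci N (n + N) + N div 2)" for n x
    using wronskian_monomials[of N "\<lambda>j. nbonacci N (n + j) + N div 2" x]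
      nbonacci_exponent[of N n] N by simp
  have pos: "real (nbonacci N (n + j)) - real (nbonacci N (n + i)) > 0"
    if "n \<ge> N" "i < j" for n i j
    using nbonacci_strict_mono[of N "n + i" "n + j"] that N by simp
  have "(\<Prod>(i, j) \<in> {(i, j). i < j \<and> j < N}.
      real (nbonacci N (n + j)) - real (nbonacci N (n + i))) \<noteq> 0" if "n \<ge> N" for n
    using pos[OF that] by (intro less_imp_neq[symmetric] prod_pos) auto
  then show ?thesis
    using wronskian pos by (intro conjI allI impI) blast+
qed

end
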